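(* Let $\mathcal{P}=(\mathcal{E},D,c,f_c)$ be a combinatorial sum problem and $E\subseteq\mathcal{E}$. Then $l'_{\mathcal{P}}(E)\le f_c(D_{+}(E))-c^\ast$.
   Context: A combinatorial sum problem (CSP) is a tuple $\mathcal{P}=(\mathcal{E},D,c,f_c)$, where $\mathcal{E}$ is a finite ground set, $D\subseteq 2^{\mathcal{E}}\setminus\{\emptyset\}$ is the set of feasible solutions, $c:\mathcal{E}\to\mathbb{R}$ and $f_c(S)=\sum_{e\in S}c(e)$ for $S\in D$. For $M\subseteq D$, $f_c(M)=\min_{S\in M}f_c(S)$, with $f_c(\emptyset)=\infty$; $c^\ast=f_c(D)$. $D_{+}(E)=\{S\in D: E\subseteq S\}$. For $E=\{e_1,\dots,e_k\}$ and $\vec\alpha\in\mathbb{R}^k$, $\mathcal{P}_{c_{-\vec\alpha,E}}$ is the CSP with cost of $e_i$ changed to $c(e_i)-\alpha_i$ and all other costs unchanged; $f_{c_{-\vec\alpha,E}}(\mathcal{P}_{c_{-\vec\alpha,E}})$ denotes its optimal value. The set lower tolerance is $l'_{\mathcal{P}}(E)=\max\{\alpha\in\mathbb{R}:$ there exists $\vec\alpha$ with all $\alpha_i\ge0$, $\alpha=\sum_i\alpha_i$, $f_{c_{-\vec\alpha,E}}(\mathcal{P}_{c_{-\vec\alpha,E}})=c^\ast\}$, with value $\infty$ if this set is unbounded. *)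

theory Defs
  imports "HOL-Library.Extended_Real"
begin

text \<open>
  The cost function is total on the type; only its values on the ground set matter, since
  feasible solutions are subsets of the ground set.  The objective function \<open>f\<^sub>c\<close> is
  determined by \<open>c\<close>, so it is not a separate field.
\<close>

record 'a csp =
  ground :: "'a set"
  feasible :: "'a set set"
  cost :: "'a \<Rightarrow> real"

definition combinatorial_sum_problem :: "'a csp \<Rightarrow> bool" where
  "combinatorial_sum_problem P \<longleftrightarrow>
     finite (ground P) \<and> feasible P \<subseteq> Pow (ground P) - {{}}"

definition sol_cost :: "'a csp \<Rightarrow> 'a set \<Rightarrow> real" where
  "sol_cost P S = (\<Sum>e\<in>S. cost P e)"

text \<open>
  Values of \<open>min_cost\<close> are extended reals, where \<open>\<infinity> - \<infinity> = \<infinity>\<close>; such a difference of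
  minimal costs arises only when there is no feasible solution at all.
\<close>

definition min_cost :: "'a csp \<Rightarrow> 'a set set \<Rightarrow> ereal" where
  "min_cost P M = (if M = {} then \<infinity> else ereal (Min (sol_cost P ` M)))"

definition opt_value :: "'a csp \<Rightarrow> ereal" where
  "opt_value P = min_cost P (feasible P)"

definition feasible_containing :: "'a csp \<Rightarrow> 'a set \<Rightarrow> 'a set set" where
  "feasible_containing P E = {S \<in> feasible P. E \<subseteq> S}"

text \<open>
  A vector \<open>(\<alpha>\<^sub>1, \<dots>, \<alpha>\<^sub>k)\<close> attached to \<open>E = {e\<^sub>1, \<dots>, e\<^sub>k}\<close> is given as a
  function on elements, \<open>\<alpha> e\<^sub>i = \<alpha>\<^sub>i\<close>; its values outside \<open>E\<close> are never used.
\<close>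

definition decrease_costs :: "'a csp \<Rightarrow> ('a \<Rightarrow> real) \<Rightarrow> 'a set \<Rightarrow> 'a csp" where
  "decrease_costs P \<alpha> E =
     P\<lparr>cost := (\<lambda>e. if e \<in> E then cost P e - \<alpha> e else cost P e)\<rparr>"

definition tolerated_decreases :: "'a csp \<Rightarrow> 'a set \<Rightarrow> real set" where
  "tolerated_decreases P E =
     {a. \<exists>\<alpha>. (\<forall>e\<in>E. \<alpha> e \<ge> 0) \<and> a = (\<Sum>e\<in>E. \<alpha> e) \<and>
             opt_value (decrease_costs P \<alpha> E) = opt_value P}"

text \<open>
  The maximum is taken over an infinite set of reals in general, hence \<open>GREATEST\<close> and not
  \<open>Max\<close>, which is meaningful for finite sets only.  For a combinatorial sum problem and
  \<open>E\<close> contained in its ground set, the maximum is attained whenever the set is bounded above: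
  the admissible vectors then form a compact polyhedron containing \<open>0\<close> (or the single empty
  vector, if \<open>E\<close> is empty).
\<close>

definition set_lower_tolerance :: "'a csp \<Rightarrow> 'a set \<Rightarrow> ereal" where
  "set_lower_tolerance P E =
     (if bdd_above (tolerated_decreases P E)
      then ereal (GREATEST a. a \<in> tolerated_decreases P E)
      else \<infinity>)"

end

theory Submission imports Defs "HOL-Analysis.Function_Topology" begin

text \<open>
  Decreasing the costs by \<open>\<alpha>\<close> lowers the cost of every \<open>S \<in> D\<^sub>+(E)\<close> by exactly the total
  decrease \<open>\<Sum>\<^sub>i \<alpha>\<^sub>i\<close>, so an unchanged optimum forces \<open>\<Sum>\<^sub>i \<alpha>\<^sub>i \<le> f\<^sub>c(S) - c\<^sup>*\<close>.
  When \<open>D\<^sub>+(E)\<close> is nonempty, this bound also makes the set of admissible vectors compact,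
  so the maximum defining the tolerance is attained and obeys the same bound.
\<close>

lemma finite_feasible:
  assumes "combinatorial_sum_problem P"
  shows "finite (feasible P)"
  using assms unfolding combinatorial_sum_problem_def
  by (auto intro: finite_subset[of _ "Pow (ground P)"])

lemma finite_feasible_solution:
  assumes "combinatorial_sum_problem P" "S \<in> feasible P"
  shows "finite S"
  using assms unfolding combinatorial_sum_problem_def by (blast intro: finite_subset)

lemma sol_cost_decrease_costs:
  assumes "finite S"
  shows "sol_cost (decrease_costs P \<alpha> E) S = sol_cost P S - sum \<alpha> (S \<inter> E)"
proof -
  have "sol_cost (decrease_costs P \<alpha> E) S = (\<Sum>e\<in>S. cost P e - (if e \<in> E then \<alpha> e else 0))"
    unfolding sol_cost_def decrease_costs_def by (auto intro: sum.cong)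
  then show ?thesis
    using assms by (simp add: sol_cost_def sum_subtractf sum.inter_restrict)
qed

text \<open>An old optimal solution does not become dearer, so the optimum can only drop. It stays
  put exactly when no solution falls below the old optimum. This turns the condition on
  \<open>\<alpha>\<close> into finitely many linear inequalities, which serve both the upper bound
  and the compactness argument.\<close>

lemma opt_value_decrease_costs_eq_iff:
  assumes P: "combinatorial_sum_problem P" and ne: "feasible P \<noteq> {}"
    and pos: "\<And>e. e \<in> E \<Longrightarrow> 0 \<le> \<alpha> e"
  shows "opt_value (decrease_costs P \<alpha> E) = opt_value P \<longleftrightarrow>
    (\<forall>S\<in>feasible P. sum \<alpha> (S \<inter> E) \<le> sol_cost P S - Min (sol_cost P ` feasible P))"
    (is "?eq \<longleftrightarrow> (\<forall>S\<in>?D. sum \<alpha> (S \<inter> E) \<le> sol_cost P S - ?c)")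
proof -
  let ?g = "\<lambda>S. sol_cost P S - sum \<alpha> (S \<inter> E)"
  have fin: "finite ?D" using finite_feasible[OF P] .
  have feas: "feasible (decrease_costs P \<alpha> E) = ?D" by (simp add: decrease_costs_def)
  have img: "sol_cost (decrease_costs P \<alpha> E) ` ?D = ?g ` ?D"
    by (intro image_cong refl sol_cost_decrease_costs finite_feasible_solution[OF P])
  have eq: "?eq \<longleftrightarrow> Min (?g ` ?D) = ?c"
    unfolding opt_value_def min_cost_def feas img using ne by simp
  have "?c \<in> sol_cost P ` ?D" using fin ne by simp
  then obtain S0 where S0: "S0 \<in> ?D" "sol_cost P S0 = ?c" by auto
  have "0 \<le> sum \<alpha> (S0 \<inter> E)" using pos by (intro sum_nonneg) auto
  moreover have "Min (?g ` ?D) \<le> ?g S0" using fin S0(1) by (intro Min_le) auto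
  ultimately have "Min (?g ` ?D) \<le> ?c" using S0(2) by linarith
  then have "?eq \<longleftrightarrow> ?c \<le> Min (?g ` ?D)" unfolding eq by auto
  also have "\<dots> \<longleftrightarrow> (\<forall>S\<in>?D. ?c \<le> ?g S)" using fin ne by simp
  also have "\<dots> \<longleftrightarrow> (\<forall>S\<in>?D. sum \<alpha> (S \<inter> E) \<le> sol_cost P S - ?c)"
    by (intro ball_cong) auto
  finally show ?thesis .
qed

text \<open>Tychonoff: the set is a product of compact intervals and singletons. Pinning the
  coordinates outside \<open>E\<close> to 0 keeps every factor compact, since the vectors are
  functions on the whole type.\<close>

lemma compact_nonneg_bounded_vectors:
  fixes B :: real
  shows "compact {\<alpha> :: 'a \<Rightarrow> real. \<forall>e. if e \<in> E then 0 \<le> \<alpha> e \<and> \<alpha> e \<le> B else \<alpha> e = 0}"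
proof -
  let ?X = "\<lambda>e. if e \<in> E then {0..B} else {0}"
  have "compactin (product_topology (\<lambda>_ :: 'a. euclideanreal) UNIV) (Pi\<^sub>E UNIV ?X)"
    unfolding compactin_PiE by simp
  then have "compact (Pi\<^sub>E UNIV ?X)"
    by (simp add: euclidean_product_topology)
  also have "Pi\<^sub>E UNIV ?X = {\<alpha>. \<forall>e. if e \<in> E then 0 \<le> \<alpha> e \<and> \<alpha> e \<le> B else \<alpha> e = 0}"
    by (auto simp: PiE_UNIV_domain Pi_iff split: if_splits)
  finally show ?thesis .
qed

text \<open>Since \<open>S\<close> contains \<open>E\<close>, the inequality for \<open>S\<close>
  involves the full sum of \<open>\<alpha>\<close> over \<open>E\<close>.\<close>

lemma tolerated_decrease_le:
  assumes P: "combinatorial_sum_problem P" and S: "S \<in> feasible_containing P E"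
    and a: "a \<in> tolerated_decreases P E"
  shows "a \<le> sol_cost P S - Min (sol_cost P ` feasible P)"
proof -
  have SD: "S \<in> feasible P" "S \<inter> E = E"
    using S by (auto simp: feasible_containing_def)
  then have ne: "feasible P \<noteq> {}" by auto
  from a obtain \<alpha> where "\<forall>e\<in>E. \<alpha> e \<ge> 0" "a = sum \<alpha> E"
      "opt_value (decrease_costs P \<alpha> E) = opt_value P"
    by (auto simp: tolerated_decreases_def)
  with SD show ?thesis
    using opt_value_decrease_costs_eq_iff[OF P ne, of E \<alpha>] by fastforce
qed

text \<open>\<open>GREATEST\<close> is only meaningful once a greatest element exists, so
  boundedness alone would not suffice. A continuous sum on a nonempty compact set of vectors
  provides one.\<close>

lemma tolerated_decreases_attains_max:
  assumes P: "combinatorial_sum_problem P" and S: "S \<in> feasible_containing P E"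
  obtains m where "m \<in> tolerated_decreases P E" "\<And>a. a \<in> tolerated_decreases P E \<Longrightarrow> a \<le> m"
proof -
  let ?c = "Min (sol_cost P ` feasible P)"
  define B where "B = sol_cost P S - ?c"
  define K where "K = {\<alpha> :: 'a \<Rightarrow> real. \<forall>e. if e \<in> E then 0 \<le> \<alpha> e \<and> \<alpha> e \<le> B else \<alpha> e = 0}"
  \<comment> \<open>For vectors nonnegative on \<open>E\<close>, membership in \<open>F\<close> says
    that the optimum is unchanged; each constraint is a closed half-space.\<close>
  define F where "F = (\<Inter>T\<in>feasible P. {\<alpha>. sum \<alpha> (T \<inter> E) \<le> sol_cost P T - ?c})"
  have SD: "S \<in> feasible P" "E \<subseteq> S" using S by (auto simp: feasible_containing_def)
  then have ne: "feasible P \<noteq> {}" and finE: "finite E"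
    using finite_feasible_solution[OF P] finite_subset by auto
  have cont: "continuous_on UNIV (\<lambda>\<alpha> :: 'a \<Rightarrow> real. sum \<alpha> A)" for A
    by (intro continuous_on_sum continuous_on_product_coordinates)
  have "closed F"
    unfolding F_def by (intro closed_INT ballI closed_Collect_le cont continuous_on_const)
  then have compact: "compact (K \<inter> F)"
    unfolding K_def by (intro compact_Int_closed compact_nonneg_bounded_vectors)
  have c_le: "?c \<le> sol_cost P T" if "T \<in> feasible P" for T
    using that finite_feasible[OF P] by simp
  \<comment> \<open>Membership in \<open>K\<close> needs \<open>0 \<le> B\<close>, which is
    optimality of \<open>?c\<close> applied to \<open>S\<close>.\<close>
  have "(\<lambda>_. 0) \<in> K \<inter> F"
    using c_le SD by (auto simp: K_def F_def B_def)
  then have "K \<inter> F \<noteq> {}" by blast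
  then obtain \<alpha> where \<alpha>: "\<alpha> \<in> K \<inter> F" and max: "\<And>\<beta>. \<beta> \<in> K \<inter> F \<Longrightarrow> sum \<beta> E \<le> sum \<alpha> E"
    using continuous_attains_sup[OF compact _ continuous_on_subset[OF cont[of E]]] by blast
  show thesis
  proof
    have pos: "\<alpha> e \<ge> 0" if "e \<in> E" for e using \<alpha> that by (auto simp: K_def split: if_splits)
    then have "opt_value (decrease_costs P \<alpha> E) = opt_value P"
      using \<alpha> opt_value_decrease_costs_eq_iff[OF P ne, of E \<alpha>] by (auto simp: F_def)
    then show "sum \<alpha> E \<in> tolerated_decreases P E"
      using pos by (auto simp: tolerated_decreases_def)
  next
    fix a assume a: "a \<in> tolerated_decreases P E"
    then obtain \<beta> where \<beta>: "\<forall>e\<in>E. \<beta> e \<ge> 0" "a = sum \<beta> E"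
        "opt_value (decrease_costs P \<beta> E) = opt_value P"
      by (auto simp: tolerated_decreases_def)
    \<comment> \<open>The values of \<open>\<beta>\<close> outside \<open>E\<close> are arbitrary,
      so \<open>\<beta>\<close> itself may lie outside \<open>K\<close>; resetting them to 0 changes
      none of the relevant sums.\<close>
    let ?\<gamma> = "\<lambda>e. if e \<in> E then \<beta> e else 0"
    have sum_eq: "sum ?\<gamma> (T \<inter> E) = sum \<beta> (T \<inter> E)" for T by (rule sum.cong) auto
    have "a \<le> B" unfolding B_def using tolerated_decrease_le[OF P S a] .
    \<comment> \<open>By nonnegativity, the bound on the total bounds every coordinate.\<close>
    moreover have "\<beta> e \<le> sum \<beta> E" if "e \<in> E" for e
      using member_le_sum[of e E \<beta>] that \<beta>(1) finE by auto
    ultimately have "?\<gamma> \<in> K" using \<beta> by (fastforce simp: K_def)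
    moreover have "?\<gamma> \<in> F"
      using \<beta> opt_value_decrease_costs_eq_iff[OF P ne, of E \<beta>]
      by (auto simp: F_def sum_eq)
    ultimately have "sum ?\<gamma> E \<le> sum \<alpha> E" by (intro max IntI)
    then show "a \<le> sum \<alpha> E" using \<beta>(2) by simp
  qed
qed

theorem theorem12:
  fixes P :: "'a csp" and E :: "'a set"
  assumes "combinatorial_sum_problem P"
    and "E \<subseteq> ground P"
  shows "set_lower_tolerance P E \<le> min_cost P (feasible_containing P E) - opt_value P"
proof (cases "feasible_containing P E = {}")
  case True
  \<comment> \<open>The right-hand side is \<open>\<infinity>\<close>, even when nothing is
    feasible, because \<open>\<infinity> - \<infinity> = \<infinity>\<close> in
    \<open>ereal\<close>.\<close>
  then show ?thesis by (simp add: min_cost_def opt_value_def)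
next
  case False
  let ?F = "feasible_containing P E"
  have sub: "?F \<subseteq> feasible P" by (auto simp: feasible_containing_def)
  then have "finite ?F" using finite_feasible[OF assms(1)] finite_subset by blast
  then have "Min (sol_cost P ` ?F) \<in> sol_cost P ` ?F" using False by simp
  \<comment> \<open>Choosing a cheapest \<open>S\<close> makes the bound for \<open>S\<close>
    coincide with the right-hand side of the claim.\<close>
  then obtain S where S: "S \<in> ?F" "Min (sol_cost P ` ?F) = sol_cost P S" by auto
  obtain m where m: "m \<in> tolerated_decreases P E"
      "\<And>a. a \<in> tolerated_decreases P E \<Longrightarrow> a \<le> m"
    using tolerated_decreases_attains_max[OF assms(1) S(1)] by blast
  then have "(GREATEST a. a \<in> tolerated_decreases P E) = m"
    by (intro Greatest_equality)
  moreover have "bdd_above (tolerated_decreases P E)" using m(2) by (rule bdd_aboveI)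
  ultimately have "set_lower_tolerance P E = ereal m"
    by (simp add: set_lower_tolerance_def)
  moreover have "m \<le> sol_cost P S - Min (sol_cost P ` feasible P)"
    using tolerated_decrease_le[OF assms(1) S(1) m(1)] .
  moreover have "feasible P \<noteq> {}" using S(1) sub by blast
  ultimately show ?thesis
    using False S(2) by (simp add: min_cost_def opt_value_def)
qed

end
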